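(* Let $M$ be a differentiable manifold, $U\subset M$ a subset and $D$ an $S$-derivation. (i) If there exists a locally holonomic basis (defined in a neighborhood of $U$) in which the components of $D$ along every vector field vanish on $U$, then $D$ is torsion free on $U$. (ii) Conversely, if $D$ is torsion free on $U$ and bases (defined in a neighborhood of $U$) in which the components of $D$ along every vector field vanish on $U$ exist, then all of them are holonomic on $U$, i.e. their basic vectors commute on $U$.
   Context: $M$ is a real differentiable manifold, $n=\dim M$; repeated Latin indices are summed from $1$ to $n$. Let $S: X\mapsto S_X$ be a fixed map (no linearity in $X$ is assumed) from the set of $C^1$ vector fields on $M$ to tensor fields of type $(1,1)$, each $S_X$ being regarded as a derivation of the tensor algebra. The $S$-derivation $D$ is the map $X\mapsto D_X:=L_X+S_X$, where $L_X$ is the Lie derivative along $X$ (so on vector fields $D_XY=[X,Y]+S_X(Y)$). For a local basis (frame) $\{E_i\}$ of vector fields, the components $(W_X)^i_{\ j}$ of $D$ along $X$ are defined by $D_X(E_j)=(W_X)^i_{\ j}E_i$. A local basis $\{E_i\}$ is holonomic if the vectors $E_1,\dots,E_n$ commute, and holonomic on $U$ if $[E_i,E_j]|_U=0$ for all $i,j$. The torsion operator of $D$ is $T^D(X,Y):=D_XY-D_YX-[X,Y]$ for vector fields $X,Y$. $D$ is torsion free on $U$ if $T^D|_U=0$, i.e. $T^D(X,Y)|_U=0$ for all vector fields $X,Y$. *)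

theory Defs
  imports "HOL-Analysis.Analysis"
begin

text \<open>\<open>f\<close> is of class $C^k$ on \<open>S\<close>; meant for open \<open>S\<close>.\<close>

primrec Ck_on :: "nat \<Rightarrow> ('a::euclidean_space \<Rightarrow> 'b::real_normed_vector) \<Rightarrow> 'a set \<Rightarrow> bool" where
  "Ck_on 0 f S = continuous_on S f"
| "Ck_on (Suc k) f S =
    ((\<forall>x\<in>S. f differentiable (at x)) \<and>
     (\<forall>b\<in>Basis. Ck_on k (\<lambda>x. frechet_derivative f (at x) b) S))"

type_synonym ('m, 'n) chart = "'m set \<times> ('m \<Rightarrow> real ^ 'n)"

abbreviation chart_dom :: "('m, 'n) chart \<Rightarrow> 'm set" where
  "chart_dom \<equiv> fst"

abbreviation chart_map :: "('m, 'n) chart \<Rightarrow> 'm \<Rightarrow> real ^ 'n" where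
  "chart_map \<equiv> snd"

definition chart_inv :: "('m, 'n) chart \<Rightarrow> real ^ 'n \<Rightarrow> 'm" where
  "chart_inv c = inv_into (chart_dom c) (chart_map c)"

definition transition :: "('m, 'n) chart \<Rightarrow> ('m, 'n) chart \<Rightarrow> real ^ 'n \<Rightarrow> real ^ 'n" where
  "transition c c' = chart_map c' \<circ> chart_inv c"

definition is_chart :: "('m::topological_space, 'n::finite) chart \<Rightarrow> bool" where
  "is_chart c \<longleftrightarrow>
     open (chart_dom c) \<and> open (chart_map c ` chart_dom c) \<and>
     homeomorphism (chart_dom c) (chart_map c ` chart_dom c) (chart_map c) (chart_inv c)"

text \<open>
  The manifold is the union of the chart domains, an open subset of a Hausdorff space, and its
  dimension is \<open>CARD('n)\<close>. Class $C^2$ is the least differentiability for which $C^1$ vector fields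
  and their brackets make sense; a smooth atlas is in particular a $C^2$ atlas and defines the same
  $C^1$ vector fields. The atlas need not be maximal.
\<close>

definition manifold_atlas :: "('m::t2_space, 'n::finite) chart set \<Rightarrow> bool" where
  "manifold_atlas A \<longleftrightarrow>
     (\<forall>c\<in>A. is_chart c) \<and>
     (\<forall>c\<in>A. \<forall>c'\<in>A. Ck_on 2 (transition c c') (chart_map c ` (chart_dom c \<inter> chart_dom c')))"

definition manifold_carrier :: "('m, 'n) chart set \<Rightarrow> 'm set" where
  "manifold_carrier A = (\<Union>c\<in>A. chart_dom c)"

definition jacobian :: "('m, 'n::finite) chart \<Rightarrow> ('m, 'n) chart \<Rightarrow> 'm \<Rightarrow> real ^ 'n ^ 'n" where
  "jacobian c c' p = matrix (frechet_derivative (transition c c') (at (chart_map c p)))"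

text \<open>
  A vector field \<open>X\<close> is the family of its components: \<open>X c p\<close> are the components at \<open>p\<close> in the
  coordinates \<open>c\<close>. Likewise for fields of type $(1,1)$. The components are set to zero where they
  have no meaning, so that different families are different fields.
\<close>

type_synonym ('m, 'n) vfield = "('m, 'n) chart \<Rightarrow> 'm \<Rightarrow> real ^ 'n"
type_synonym ('m, 'n) tfield = "('m, 'n) chart \<Rightarrow> 'm \<Rightarrow> real ^ 'n ^ 'n"

definition vector_field_on :: "('m, 'n::finite) chart set \<Rightarrow> 'm set \<Rightarrow> ('m, 'n) vfield \<Rightarrow> bool" where
  "vector_field_on A V X \<longleftrightarrow>
     (\<forall>c\<in>A. \<forall>c'\<in>A. \<forall>p \<in> V \<inter> chart_dom c \<inter> chart_dom c'. X c' p = jacobian c c' p *v X c p) \<and>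
     (\<forall>c p. \<not> (c \<in> A \<and> p \<in> V \<inter> chart_dom c) \<longrightarrow> X c p = 0)"

definition C1_vector_field_on :: "('m, 'n::finite) chart set \<Rightarrow> 'm set \<Rightarrow> ('m, 'n) vfield \<Rightarrow> bool" where
  "C1_vector_field_on A V X \<longleftrightarrow>
     vector_field_on A V X \<and>
     (\<forall>c\<in>A. Ck_on 1 (\<lambda>x. X c (chart_inv c x)) (chart_map c ` (V \<inter> chart_dom c)))"

abbreviation C1_vector_field :: "('m, 'n::finite) chart set \<Rightarrow> ('m, 'n) vfield \<Rightarrow> bool" where
  "C1_vector_field A \<equiv> C1_vector_field_on A (manifold_carrier A)"

definition tensor11_field :: "('m, 'n::finite) chart set \<Rightarrow> ('m, 'n) tfield \<Rightarrow> bool" where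
  "tensor11_field A T \<longleftrightarrow>
     (\<forall>c\<in>A. \<forall>c'\<in>A. \<forall>p \<in> chart_dom c \<inter> chart_dom c'.
        T c' p = jacobian c c' p ** T c p ** jacobian c' c p) \<and>
     (\<forall>c p. \<not> (c \<in> A \<and> p \<in> chart_dom c) \<longrightarrow> T c p = 0)"

text \<open>
  $[X,Y]^i = X^j \partial_j Y^i - Y^j \partial_j X^i$ in each chart. The value at \<open>(c, p)\<close> is
  meaningful for \<open>p\<close> in \<open>chart_dom c\<close> and in the open set on which both fields are defined, and
  it is only used there.
\<close>

definition lie_bracket :: "('m, 'n::finite) vfield \<Rightarrow> ('m, 'n) vfield \<Rightarrow> ('m, 'n) vfield" where
  "lie_bracket X Y c p =
     frechet_derivative (\<lambda>x. Y c (chart_inv c x)) (at (chart_map c p)) (X c p) -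
     frechet_derivative (\<lambda>x. X c (chart_inv c x)) (at (chart_map c p)) (Y c p)"

text \<open>The map $X \mapsto S_X$ is neither required to be linear in $X$ nor continuous in any sense.\<close>

definition S_map :: "('m, 'n::finite) chart set \<Rightarrow> (('m, 'n) vfield \<Rightarrow> ('m, 'n) tfield) \<Rightarrow> bool" where
  "S_map A S \<longleftrightarrow> (\<forall>X. C1_vector_field A X \<longrightarrow> tensor11_field A (S X))"

text \<open>
  The action of $D_X = L_X + S_X$ on vector fields. It is the only part of the derivation that
  enters the notions below.
\<close>

definition S_derivation ::
  "(('m, 'n::finite) vfield \<Rightarrow> ('m, 'n) tfield) \<Rightarrow> ('m, 'n) vfield \<Rightarrow> ('m, 'n) vfield \<Rightarrow> ('m, 'n) vfield"
  where "S_derivation S X Y c p = lie_bracket X Y c p + S X c p *v Y c p"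

definition torsion ::
  "(('m, 'n::finite) vfield \<Rightarrow> ('m, 'n) tfield) \<Rightarrow> ('m, 'n) vfield \<Rightarrow> ('m, 'n) vfield \<Rightarrow> ('m, 'n) vfield"
  where "torsion S X Y c p = S_derivation S X Y c p - S_derivation S Y X c p - lie_bracket X Y c p"

definition vanishes_on :: "('m, 'n) chart set \<Rightarrow> 'm set \<Rightarrow> ('m, 'n::finite) vfield \<Rightarrow> bool" where
  "vanishes_on A U Z \<longleftrightarrow> (\<forall>c\<in>A. \<forall>p \<in> U \<inter> chart_dom c. Z c p = 0)"

definition torsion_free_on ::
  "('m, 'n::finite) chart set \<Rightarrow> (('m, 'n) vfield \<Rightarrow> ('m, 'n) tfield) \<Rightarrow> 'm set \<Rightarrow> bool" where
  "torsion_free_on A S U \<longleftrightarrow>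
     (\<forall>X Y. C1_vector_field A X \<longrightarrow> C1_vector_field A Y \<longrightarrow> vanishes_on A U (torsion S X Y))"

definition local_basis ::
  "('m::t2_space, 'n::finite) chart set \<Rightarrow> 'm set \<Rightarrow> ('n \<Rightarrow> ('m, 'n) vfield) \<Rightarrow> bool" where
  "local_basis A V E \<longleftrightarrow>
     open V \<and> V \<subseteq> manifold_carrier A \<and> (\<forall>i. C1_vector_field_on A V (E i)) \<and>
     (\<forall>c\<in>A. \<forall>p \<in> V \<inter> chart_dom c.
        inj (\<lambda>i. E i c p) \<and> independent (range (\<lambda>i. E i c p)) \<and> span (range (\<lambda>i. E i c p)) = UNIV)"

definition holonomic_on ::
  "('m, 'n::finite) chart set \<Rightarrow> 'm set \<Rightarrow> ('n \<Rightarrow> ('m, 'n) vfield) \<Rightarrow> bool" where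
  "holonomic_on A U E \<longleftrightarrow> (\<forall>i j. vanishes_on A U (lie_bracket (E i) (E j)))"

text \<open>
  The entries \<open>W p $ i $ j\<close> are the components $(W_X)^i{}_j$ at \<open>p\<close>, i.e.\ the coefficients in
  $D_X(E_j) = (W_X)^i{}_j E_i$ on the domain \<open>V\<close> of the basis. The same \<open>W p\<close> serves all charts
  around \<open>p\<close>, and \<open>W\<close> is determined on \<open>V\<close> because the \<open>E i\<close> form a basis.
\<close>

definition components_along ::
  "('m, 'n::finite) chart set \<Rightarrow> (('m, 'n) vfield \<Rightarrow> ('m, 'n) tfield) \<Rightarrow>
   'm set \<Rightarrow> ('n \<Rightarrow> ('m, 'n) vfield) \<Rightarrow> ('m, 'n) vfield \<Rightarrow> ('m \<Rightarrow> real ^ 'n ^ 'n) \<Rightarrow> bool" where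
  "components_along A S V E X W \<longleftrightarrow>
     (\<forall>c\<in>A. \<forall>p \<in> V \<inter> chart_dom c. \<forall>j.
        S_derivation S X (E j) c p = (\<Sum>i\<in>UNIV. W p $ i $ j *\<^sub>R E i c p))"

definition components_vanish_on ::
  "('m, 'n::finite) chart set \<Rightarrow> (('m, 'n) vfield \<Rightarrow> ('m, 'n) tfield) \<Rightarrow>
   'm set \<Rightarrow> ('n \<Rightarrow> ('m, 'n) vfield) \<Rightarrow> 'm set \<Rightarrow> bool" where
  "components_vanish_on A S V E U \<longleftrightarrow>
     (\<forall>X. C1_vector_field A X \<longrightarrow>
        (\<exists>W. components_along A S V E X W \<and> (\<forall>p\<in>U. W p = 0)))"

end

theory Submission
  imports Defs
begin

text \<open>
  Both directions follow from one pointwise identity. Suppose that the components of $D$ along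
  every field vanish at a point $p$ in the basis $E_i$, so that $S_X(E_j) = -[X, E_j]$ at $p$.
  The tensor $S_X$ acts pointwise, so for $Y(p) = y^j E_j(p)$ this determines $S_X(Y)$ at $p$,
  although $S$ is arbitrary otherwise. In coordinates the derivatives of $X$ cancel and
  \[ (D_X Y)(p) = \partial_X Y - y^j\, \partial_X E_j . \]
  With $X(p) = x^i E_i(p)$, antisymmetrising gives
  \[ T^D(X, Y)(p) = - x^i y^j\, [E_i, E_j](p) , \]
  which is \<open>torsion_vanishing_components\<close>. The numbers $x^i$, $y^j$ enter only at $p$; they are never
  differentiated as functions. If the basis commutes, the right-hand side vanishes, which
  is (i).

  For (ii) one takes $X(p) = E_i(p)$ and $Y(p) = E_j(p)$, so that the right-hand side is
  $-[E_i, E_j](p)$. The torsion condition speaks of fields on the whole manifold, whereas the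
  $E_i$ live only near \<open>U\<close>. Hence the $E_i$ are cut off by a bump function of class C1 that
  is 1 at $p$ (\<open>C1_vector_field_with_value\<close>).
\<close>

section \<open>Functions of class C1\<close>

lemma Ck_on_1I:
  assumes "\<And>x. x \<in> S \<Longrightarrow> (f has_derivative f' x) (at x)"
    and "\<And>b. b \<in> Basis \<Longrightarrow> continuous_on S (\<lambda>x. f' x b)"
  shows "Ck_on 1 f S"
proof -
  have "continuous_on S (\<lambda>x. frechet_derivative f (at x) b)" if "b \<in> Basis" for b
  proof (rule continuous_on_eq[OF assms(2)[OF that]])
    show "f' x b = frechet_derivative f (at x) b" if "x \<in> S" for x
      using frechet_derivative_at[OF assms(1)[OF that]] by simp
  qed
  then show ?thesis
    using assms(1) by (auto simp: differentiable_def)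
qed

lemma Ck_on_1_has_derivative:
  assumes "Ck_on 1 f S" "x \<in> S"
  shows "(f has_derivative frechet_derivative f (at x)) (at x)"
  using assms by (auto simp: frechet_derivative_works)

lemma Ck_on_1_continuous:
  assumes "Ck_on 1 f S"
  shows "continuous_on S f"
  using assms by (auto intro!: continuous_at_imp_continuous_on differentiable_imp_continuous_within)

lemma Ck_on_1_continuous_derivative:
  assumes "Ck_on 1 f S" "b \<in> Basis"
  shows "continuous_on S (\<lambda>x. frechet_derivative f (at x) b)"
  using assms by auto

lemma Ck_on_subset:
  assumes "Ck_on k f S" "T \<subseteq> S"
  shows "Ck_on k f T"
  using assms by (induction k arbitrary: f) (auto intro: continuous_on_subset)

lemma Ck_on_SucD:
  assumes "Ck_on (Suc k) f S"
  shows "Ck_on k f S"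
  using assms
proof (induction k arbitrary: f)
  case 0
  then show ?case
    by (auto intro!: continuous_at_imp_continuous_on differentiable_imp_continuous_within)
next
  case (Suc k)
  then show ?case by auto
qed

lemma Ck_on_1_Un:
  assumes "open S" "open T" "Ck_on 1 f S" "Ck_on 1 f T"
  shows "Ck_on 1 f (S \<union> T)"
  using assms by (auto intro!: continuous_on_open_Un)

lemma Ck_on_1_cong:
  assumes "open S" "Ck_on 1 f S" "\<And>x. x \<in> S \<Longrightarrow> f x = g x"
  shows "Ck_on 1 g S"
proof (rule Ck_on_1I)
  show "(g has_derivative frechet_derivative f (at x)) (at x)" if "x \<in> S" for x
    using has_derivative_transform_within_open[OF Ck_on_1_has_derivative[OF assms(2) that]]
      assms(1,3) that by blast
  show "continuous_on S (\<lambda>x. frechet_derivative f (at x) b)" if "b \<in> Basis" for b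
    using Ck_on_1_continuous_derivative[OF assms(2) that] .
qed

lemma Ck_on_1_const: "Ck_on 1 (\<lambda>x. a) S"
  by (rule Ck_on_1I[where f' = "\<lambda>x v. 0"]) auto

lemma Ck_on_1_scaleR:
  fixes f :: "'a::euclidean_space \<Rightarrow> real"
  assumes f: "Ck_on 1 f S" and g: "Ck_on 1 g S"
  shows "Ck_on 1 (\<lambda>x. f x *\<^sub>R g x) S"
proof (rule Ck_on_1I)
  show "((\<lambda>x. f x *\<^sub>R g x) has_derivative
      (\<lambda>v. f x *\<^sub>R frechet_derivative g (at x) v + frechet_derivative f (at x) v *\<^sub>R g x)) (at x)"
    if "x \<in> S" for x
    by (rule has_derivative_scaleR[OF Ck_on_1_has_derivative[OF f that]
          Ck_on_1_has_derivative[OF g that]])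
  show "continuous_on S (\<lambda>x. f x *\<^sub>R frechet_derivative g (at x) b
      + frechet_derivative f (at x) b *\<^sub>R g x)" if "b \<in> Basis" for b
    by (intro continuous_intros Ck_on_1_continuous f g Ck_on_1_continuous_derivative that)
qed

lemma Ck_on_1_compose:
  fixes f :: "'a::euclidean_space \<Rightarrow> 'b::euclidean_space"
  assumes f: "Ck_on 1 f S" and g: "Ck_on 1 g T" and sub: "f ` S \<subseteq> T"
  shows "Ck_on 1 (\<lambda>x. g (f x)) S"
proof (rule Ck_on_1I)
  let ?Df = "\<lambda>x. frechet_derivative f (at x)" and ?Dg = "\<lambda>y. frechet_derivative g (at y)"
  \<comment> \<open>Continuity of the derivative of \<open>g\<close> is known only along basis vectors, so the chain rule
    is expanded in the basis.\<close>
  let ?D = "\<lambda>x v. \<Sum>e\<in>Basis. (?Df x v \<bullet> e) *\<^sub>R ?Dg (f x) e"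
  show "((\<lambda>x. g (f x)) has_derivative ?D x) (at x)" if "x \<in> S" for x
  proof -
    have *: "(g has_derivative ?Dg (f x)) (at (f x))"
      using Ck_on_1_has_derivative[OF g] sub that by blast
    then have lin: "linear (?Dg (f x))"
      by (rule has_derivative_linear)
    have "?Dg (f x) (?Df x v) = ?D x v" for v
    proof -
      have "?Dg (f x) (?Df x v) = ?Dg (f x) (\<Sum>e\<in>Basis. (?Df x v \<bullet> e) *\<^sub>R e)"
        by (simp only: euclidean_representation)
      then show ?thesis
        by (simp add: linear_sum[OF lin] linear_cmul[OF lin])
    qed
    with has_derivative_compose[OF Ck_on_1_has_derivative[OF f that] *] show ?thesis
      by simp
  qed
  show "continuous_on S (\<lambda>x. ?D x b)" if "b \<in> Basis" for b
    by (intro continuous_intros Ck_on_1_continuous_derivative[OF f that]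
        continuous_on_compose2[OF Ck_on_1_continuous_derivative[OF g]] Ck_on_1_continuous[OF f] sub)
qed

section \<open>Global fields with a prescribed value\<close>

text \<open>
  Class C1 is all that a vector field on a C2 manifold can have in every chart, so a quadratic
  profile is smooth enough for a cutoff.
\<close>

lemma C1_square_pos_part: "Ck_on 1 (\<lambda>t::real. (max 0 t)\<^sup>2) UNIV"
proof (rule Ck_on_1I)
  fix t :: real
  have "((\<lambda>t. (max 0 t)\<^sup>2) has_field_derivative 2 * max 0 t) (at t)"
  proof (cases t "0::real" rule: linorder_cases)
    case less
    have "((\<lambda>t. 0) has_field_derivative 0) (at t)" by simp
    then have "((\<lambda>t. (max 0 t)\<^sup>2) has_field_derivative 0) (at t)"
      by (rule has_field_derivative_transform_within_open[where S = "{..<0}"]) (use less in auto)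
    then show ?thesis using less by simp
  next
    case greater
    have "((\<lambda>t. t\<^sup>2) has_field_derivative 2 * t) (at t)"
      by (auto intro!: derivative_eq_intros)
    then have "((\<lambda>t. (max 0 t)\<^sup>2) has_field_derivative 2 * t) (at t)"
      by (rule has_field_derivative_transform_within_open[where S = "{0<..}"]) (use greater in auto)
    then show ?thesis using greater by simp
  next
    case equal
    have "((\<lambda>y::real. max 0 y) \<longlongrightarrow> 0) (at 0)"
      by (auto intro!: tendsto_eq_intros)
    then have "((\<lambda>y::real. ((max 0 y)\<^sup>2 - (max 0 0)\<^sup>2) / (y - 0)) \<longlongrightarrow> 0) (at 0)"
      by (rule Lim_transform_eventually) (auto simp: eventually_at_filter max_def power2_eq_square)
    then show ?thesis
      using equal by (simp add: has_field_derivative_iff)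
  qed
  then show "((\<lambda>t. (max 0 t)\<^sup>2) has_derivative (\<lambda>v. 2 * max 0 t * v)) (at t)"
    by (simp add: has_field_derivative_def)
qed (intro continuous_intros)

lemma C1_bump:
  fixes a :: "'a::euclidean_space"
  assumes "r > 0"
  obtains h :: "'a \<Rightarrow> real" where "Ck_on 1 h UNIV" "h a = 1" "\<And>x. x \<notin> cball a r \<Longrightarrow> h x = 0"
proof
  define q where "q = (\<lambda>x. 1 - inverse (r\<^sup>2) * ((x - a) \<bullet> (x - a)))"
  have "Ck_on 1 q UNIV"
  proof (rule Ck_on_1I)
    show "(q has_derivative (\<lambda>v. - (inverse (r\<^sup>2) * (2 * ((x - a) \<bullet> v))))) (at x)" for x
      unfolding q_def by (auto intro!: derivative_eq_intros simp: inner_commute)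
  qed (use assms in \<open>auto intro!: continuous_intros\<close>)
  then show "Ck_on 1 (\<lambda>x. (max 0 (q x))\<^sup>2) UNIV"
    by (rule Ck_on_1_compose[OF _ C1_square_pos_part]) auto
  show "(max 0 (q a))\<^sup>2 = 1"
    by (simp add: q_def)
  show "(max 0 (q x))\<^sup>2 = 0" if "x \<notin> cball a r" for x
  proof -
    have "r \<le> norm (x - a)"
      using that by (simp add: dist_norm norm_minus_commute)
    then have "r\<^sup>2 \<le> (norm (x - a))\<^sup>2"
      using assms by (intro power_mono) auto
    then have "q x \<le> 0"
      using assms by (simp add: q_def power2_norm_eq_inner field_simps)
    then show ?thesis by simp
  qed
qed

lemma chart_inv_chart_map:
  assumes "is_chart c" "p \<in> chart_dom c"
  shows "chart_inv c (chart_map c p) = p"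
  using assms by (auto simp: is_chart_def homeomorphism_def)

lemma open_chart_image:
  assumes c: "is_chart c" and W: "open W" "W \<subseteq> chart_dom c"
  shows "open (chart_map c ` W)"
proof -
  have "openin (top_of_set (chart_map c ` chart_dom c)) (chart_map c ` W)"
  proof (rule homeomorphism_imp_open_map)
    show "homeomorphism (chart_dom c) (chart_map c ` chart_dom c) (chart_map c) (chart_inv c)"
      using c by (simp add: is_chart_def)
    show "openin (top_of_set (chart_dom c)) W"
      using W by (intro open_subset)
  qed
  then show ?thesis
    using c by (auto simp: is_chart_def intro: openin_open_trans)
qed

lemma C1_vector_field_on_differentiable:
  assumes "C1_vector_field_on A V X" "c \<in> A" "p \<in> V \<inter> chart_dom c"
  shows "(\<lambda>x. X c (chart_inv c x)) differentiable (at (chart_map c p))"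
  using assms by (auto simp: C1_vector_field_on_def)

text \<open>
  The transformation law of vector fields is linear at each point, so multiplying a field by a
  scalar function respects it. A bump function with compact support inside \<open>V\<close> and one chart
  domain therefore turns the local field into a global one, and only differentiability in the
  other charts has to be checked.
\<close>

lemma C1_vector_field_with_value:
  assumes A: "manifold_atlas A" and V: "open V" "V \<subseteq> manifold_carrier A"
    and Z: "C1_vector_field_on A V Z" and c: "c \<in> A" and p: "p \<in> V \<inter> chart_dom c"
  obtains X where "C1_vector_field A X" "X c p = Z c p"
proof -
  have chart: "is_chart c'" if "c' \<in> A" for c'
    using A that by (simp add: manifold_atlas_def)
  then have dom: "open (chart_dom c')" if "c' \<in> A" for c'
    using that by (simp add: is_chart_def)
  let ?G = "chart_map c ` (V \<inter> chart_dom c)"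
  have "open ?G"
    using V(1) dom[OF c] c by (intro open_chart_image chart open_Int) auto
  then obtain r where r: "r > 0" "cball (chart_map c p) r \<subseteq> ?G"
    using p open_contains_cball by blast
  obtain h :: "real ^ 'b \<Rightarrow> real" where h: "Ck_on 1 h UNIV" "h (chart_map c p) = 1"
    "\<And>x. x \<notin> cball (chart_map c p) r \<Longrightarrow> h x = 0"
    using C1_bump[OF r(1)] by blast
  define \<phi> where "\<phi> = (\<lambda>q. if q \<in> chart_dom c then h (chart_map c q) else 0)"
  define K where "K = chart_inv c ` cball (chart_map c p) r"
  have "continuous_on (cball (chart_map c p) r) (chart_inv c)"
    using chart[OF c] r by (auto simp: is_chart_def homeomorphism_def intro: continuous_on_subset)
  then have "closed K"
    unfolding K_def by (intro compact_imp_closed compact_continuous_image) auto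
  have KV: "K \<subseteq> V \<inter> chart_dom c"
  proof
    fix q assume "q \<in> K"
    then obtain x where "q = chart_inv c x" "x \<in> ?G"
      using r unfolding K_def by blast
    then show "q \<in> V \<inter> chart_dom c"
      using chart_inv_chart_map[OF chart[OF c]] by auto
  qed
  have \<phi>_0: "\<phi> q = 0" if "q \<notin> K" for q
  proof (cases "q \<in> chart_dom c")
    case True
    then have "chart_map c q \<notin> cball (chart_map c p) r"
      using chart_inv_chart_map[OF chart[OF c] True] that unfolding K_def by (metis imageI)
    then show ?thesis by (simp add: \<phi>_def h)
  qed (simp add: \<phi>_def)
  define X where "X = (\<lambda>c' q. \<phi> q *\<^sub>R Z c' q)"
  have Zv: "vector_field_on A V Z"
    using Z by (simp add: C1_vector_field_on_def)
  have "vector_field_on A (manifold_carrier A) X"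
    unfolding vector_field_on_def
  proof (intro conjI ballI allI impI)
    fix c1 c2 q
    assume q: "c1 \<in> A" "c2 \<in> A" "q \<in> manifold_carrier A \<inter> chart_dom c1 \<inter> chart_dom c2"
    show "X c2 q = jacobian c1 c2 q *v X c1 q"
    proof (cases "q \<in> V")
      case True
      then have "Z c2 q = jacobian c1 c2 q *v Z c1 q"
        using Zv q unfolding vector_field_on_def by blast
      then show ?thesis
        by (simp add: X_def matrix_vector_mult_scaleR)
    next
      case False
      then show ?thesis
        using \<phi>_0[of q] KV by (force simp: X_def)
    qed
  next
    fix c1 q
    assume "\<not> (c1 \<in> A \<and> q \<in> manifold_carrier A \<inter> chart_dom c1)"
    then have "Z c1 q = 0"
      using Zv V(2) unfolding vector_field_on_def by blast
    then show "X c1 q = 0" by (simp add: X_def)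
  qed
  moreover have "Ck_on 1 (\<lambda>x. X d (chart_inv d x)) (chart_map d ` (manifold_carrier A \<inter> chart_dom d))"
    if d: "d \<in> A" for d
  proof -
    \<comment> \<open>Hausdorffness makes \<open>K\<close> closed, so the domain of \<open>d\<close> is covered by two open sets: on one
      the factors \<open>\<phi>\<close> and \<open>Z\<close> are both of class C1, on the other the product is zero.\<close>
    let ?P = "chart_map d ` (V \<inter> chart_dom c \<inter> chart_dom d)"
    let ?Q = "chart_map d ` (chart_dom d - K)"
    have inv: "chart_inv d (chart_map d q) = q" if "q \<in> chart_dom d" for q
      using chart_inv_chart_map[OF chart[OF d] that] .
    have PQ: "open ?P" "open ?Q"
      using V(1) dom[OF c] dom[OF d] \<open>closed K\<close>
      by (auto intro!: open_chart_image chart[OF d])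
    have "Ck_on 1 (\<lambda>x. X d (chart_inv d x)) ?P"
    proof -
      have "Ck_on 2 (transition d c) (chart_map d ` (chart_dom d \<inter> chart_dom c))"
        using A c d by (auto simp: manifold_atlas_def)
      then have "Ck_on 1 (transition d c) (chart_map d ` (chart_dom d \<inter> chart_dom c))"
        by (intro Ck_on_SucD[of 1]) (simp only: Suc_1)
      then have "Ck_on 1 (transition d c) ?P"
        by (rule Ck_on_subset) auto
      then have "Ck_on 1 (\<lambda>x. h (transition d c x)) ?P"
        by (rule Ck_on_1_compose[OF _ h(1)]) auto
      then have "Ck_on 1 (\<lambda>x. \<phi> (chart_inv d x)) ?P"
        by (rule Ck_on_1_cong[OF PQ(1)]) (auto simp: inv \<phi>_def transition_def)
      moreover have "Ck_on 1 (\<lambda>x. Z d (chart_inv d x)) ?P"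
      proof (rule Ck_on_subset)
        show "Ck_on 1 (\<lambda>x. Z d (chart_inv d x)) (chart_map d ` (V \<inter> chart_dom d))"
          using Z d by (simp add: C1_vector_field_on_def)
      qed auto
      ultimately show ?thesis
        unfolding X_def by (rule Ck_on_1_scaleR)
    qed
    moreover have "Ck_on 1 (\<lambda>x. X d (chart_inv d x)) ?Q"
      by (rule Ck_on_1_cong[OF PQ(2) Ck_on_1_const[of 0]]) (auto simp: inv X_def \<phi>_0)
    moreover have "chart_map d ` (manifold_carrier A \<inter> chart_dom d) \<subseteq> ?P \<union> ?Q"
      using KV by auto
    ultimately show ?thesis
      using Ck_on_subset[OF Ck_on_1_Un[OF PQ]] by blast
  qed
  ultimately have "C1_vector_field A X"
    by (simp add: C1_vector_field_on_def)
  moreover have "X c p = Z c p"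
    using p h(2) by (simp add: X_def \<phi>_def)
  ultimately show ?thesis ..
qed

section \<open>Torsion in a basis with vanishing components\<close>

abbreviation chart_derivative ::
  "('m, 'n::finite) vfield \<Rightarrow> ('m, 'n) chart \<Rightarrow> 'm \<Rightarrow> real ^ 'n \<Rightarrow> real ^ 'n" where
  "chart_derivative X c p \<equiv> frechet_derivative (\<lambda>x. X c (chart_inv c x)) (at (chart_map c p))"

text \<open>
  \<open>D\<^sub>X E\<^sub>j = 0\<close> at \<open>p\<close> expresses \<open>S\<^sub>X\<close> on the basis through derivatives of \<open>X\<close> and \<open>E\<^sub>j\<close>. By linearity
  at \<open>p\<close>, the part of \<open>S\<^sub>X(Y)\<close> that differentiates \<open>X\<close> is the derivative of \<open>X\<close> in the direction \<open>Y\<close>,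
  and it cancels against the corresponding term of the bracket.
\<close>

lemma S_derivation_vanishing_components:
  fixes E :: "'n::finite \<Rightarrow> ('m::t2_space, 'n) vfield"
  assumes W: "components_vanish_on A S V E U"
    and X: "C1_vector_field A X" and c: "c \<in> A" and p: "p \<in> U \<inter> V \<inter> chart_dom c"
    and y: "Y c p = (\<Sum>j\<in>UNIV. y j *\<^sub>R E j c p)"
  shows "S_derivation S X Y c p =
    chart_derivative Y c p (X c p) - (\<Sum>j\<in>UNIV. y j *\<^sub>R chart_derivative (E j) c p (X c p))"
proof -
  have "p \<in> manifold_carrier A"
    using c p by (auto simp: manifold_carrier_def)
  then have lin: "linear (chart_derivative X c p)"
    using C1_vector_field_on_differentiable[OF X c] p by (auto intro: linear_frechet_derivative)
  have SE: "S X c p *v E j c p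
      = chart_derivative X c p (E j c p) - chart_derivative (E j) c p (X c p)" for j
  proof -
    have "S_derivation S X (E j) c p = 0"
      using W X c p unfolding components_vanish_on_def components_along_def by fastforce
    then show ?thesis
      by (simp add: S_derivation_def lie_bracket_def algebra_simps)
  qed
  have "S X c p *v Y c p = (\<Sum>j\<in>UNIV. y j *\<^sub>R (S X c p *v E j c p))"
    unfolding y by (simp add: linear_sum[OF matrix_vector_mul_linear] matrix_vector_mult_scaleR)
  also have "\<dots> = chart_derivative X c p (Y c p)
      - (\<Sum>j\<in>UNIV. y j *\<^sub>R chart_derivative (E j) c p (X c p))"
    unfolding y SE by (simp add: linear_sum[OF lin] linear_cmul[OF lin] scaleR_diff_right sum_subtractf)
  finally show ?thesis
    by (simp add: S_derivation_def lie_bracket_def)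
qed

text \<open>
  The derivatives of \<open>X\<close> and \<open>Y\<close> in \<open>D\<^sub>X Y - D\<^sub>Y X\<close> make up the bracket \<open>[X, Y]\<close>, which the torsion
  subtracts. Only derivatives of the basis along the basis remain, and pairing them by
  antisymmetry gives the brackets of the basis.
\<close>

lemma torsion_vanishing_components:
  fixes E :: "'n::finite \<Rightarrow> ('m::t2_space, 'n) vfield"
  assumes E: "local_basis A V E" and W: "components_vanish_on A S V E U"
    and X: "C1_vector_field A X" and Y: "C1_vector_field A Y"
    and c: "c \<in> A" and p: "p \<in> U \<inter> V \<inter> chart_dom c"
    and x: "X c p = (\<Sum>i\<in>UNIV. x i *\<^sub>R E i c p)"
    and y: "Y c p = (\<Sum>j\<in>UNIV. y j *\<^sub>R E j c p)"
  shows "torsion S X Y c p =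
    - (\<Sum>i\<in>UNIV. \<Sum>j\<in>UNIV. (x i * y j) *\<^sub>R lie_bracket (E i) (E j) c p)"
proof -
  let ?D = "\<lambda>i j. chart_derivative (E i) c p (E j c p)"
  have lin: "linear (chart_derivative (E i) c p)" for i
    using E C1_vector_field_on_differentiable[of A V "E i" c p] c p
    by (auto simp: local_basis_def intro: linear_frechet_derivative)
  have DX: "(\<Sum>j\<in>UNIV. y j *\<^sub>R chart_derivative (E j) c p (X c p))
      = (\<Sum>i\<in>UNIV. \<Sum>j\<in>UNIV. (x i * y j) *\<^sub>R ?D j i)"
    unfolding x by (subst sum.swap)
      (simp add: linear_sum[OF lin] linear_cmul[OF lin] scaleR_sum_right mult.commute)
  have DY: "(\<Sum>i\<in>UNIV. x i *\<^sub>R chart_derivative (E i) c p (Y c p))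
      = (\<Sum>i\<in>UNIV. \<Sum>j\<in>UNIV. (x i * y j) *\<^sub>R ?D i j)"
    unfolding y by (simp add: linear_sum[OF lin] linear_cmul[OF lin] scaleR_sum_right)
  have "torsion S X Y c p = (\<Sum>i\<in>UNIV. x i *\<^sub>R chart_derivative (E i) c p (Y c p))
      - (\<Sum>j\<in>UNIV. y j *\<^sub>R chart_derivative (E j) c p (X c p))"
    unfolding torsion_def
      S_derivation_vanishing_components[where Y = Y and y = y, OF W X c p y]
      S_derivation_vanishing_components[where Y = X and y = x, OF W Y c p x]
    by (simp add: lie_bracket_def)
  also have "\<dots> = - (\<Sum>i\<in>UNIV. \<Sum>j\<in>UNIV. (x i * y j) *\<^sub>R (?D j i - ?D i j))"
    unfolding DX DY by (simp add: scaleR_diff_right sum_subtractf)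
  finally show ?thesis
    by (simp add: lie_bracket_def)
qed

lemma local_basis_coefficients:
  fixes E :: "'n::finite \<Rightarrow> ('m::t2_space, 'n) vfield"
  assumes "local_basis A V E" "c \<in> A" "p \<in> V \<inter> chart_dom c"
  obtains x where "v = (\<Sum>i\<in>UNIV. x i *\<^sub>R E i c p)"
proof -
  have "inj (\<lambda>i. E i c p)" "v \<in> span (range (\<lambda>i. E i c p))"
    using assms by (auto simp: local_basis_def)
  then obtain u where "v = (\<Sum>i\<in>UNIV. u (E i c p) *\<^sub>R E i c p)"
    by (auto simp: span_finite sum.reindex)
  then show ?thesis
    by (rule that[of "\<lambda>i. u (E i c p)"])
qed

theorem proposition6:
  fixes A :: "('m::t2_space, 'n::finite) chart set"
    and S :: "('m, 'n) vfield \<Rightarrow> ('m, 'n) tfield"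
    and U :: "'m set"
  assumes "manifold_atlas A"
    and "S_map A S"
    and "U \<subseteq> manifold_carrier A"
  shows "((\<exists>V E. local_basis A V E \<and> U \<subseteq> V \<and> holonomic_on A V E \<and>
             components_vanish_on A S V E U)
           \<longrightarrow> torsion_free_on A S U) \<and>
         (torsion_free_on A S U \<longrightarrow>
           (\<forall>V E. local_basis A V E \<and> U \<subseteq> V \<and> components_vanish_on A S V E U
              \<longrightarrow> holonomic_on A U E))"
proof (intro conjI impI allI)
  assume "\<exists>V E. local_basis A V E \<and> U \<subseteq> V \<and> holonomic_on A V E \<and> components_vanish_on A S V E U"
  then obtain V E where E: "local_basis A V E" and UV: "U \<subseteq> V" and hol: "holonomic_on A V E"
    and W: "components_vanish_on A S V E U"
    by blast
  show "torsion_free_on A S U"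
    unfolding torsion_free_on_def vanishes_on_def
  proof (intro allI impI ballI)
    fix X Y c p
    assume X: "C1_vector_field A X" and Y: "C1_vector_field A Y" and c: "c \<in> A"
      and "p \<in> U \<inter> chart_dom c"
    then have p: "p \<in> U \<inter> V \<inter> chart_dom c" and pV: "p \<in> V \<inter> chart_dom c"
      using UV by auto
    obtain x where x: "X c p = (\<Sum>i\<in>UNIV. x i *\<^sub>R E i c p)"
      using local_basis_coefficients[OF E c pV] by blast
    obtain y where y: "Y c p = (\<Sum>j\<in>UNIV. y j *\<^sub>R E j c p)"
      using local_basis_coefficients[OF E c pV] by blast
    have "lie_bracket (E i) (E j) c p = 0" for i j
      using hol c pV by (simp add: holonomic_on_def vanishes_on_def)
    then show "torsion S X Y c p = 0"
      by (simp add: torsion_vanishing_components[OF E W X Y c p x y])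
  qed
next
  fix V E
  assume tf: "torsion_free_on A S U"
    and "local_basis A V E \<and> U \<subseteq> V \<and> components_vanish_on A S V E U"
  then have E: "local_basis A V E" and UV: "U \<subseteq> V" and W: "components_vanish_on A S V E U"
    by auto
  show "holonomic_on A U E"
    unfolding holonomic_on_def vanishes_on_def
  proof (intro allI ballI)
    fix i j c p
    assume c: "c \<in> A" and "p \<in> U \<inter> chart_dom c"
    then have pU: "p \<in> U \<inter> chart_dom c" and p: "p \<in> U \<inter> V \<inter> chart_dom c"
      and pV: "p \<in> V \<inter> chart_dom c"
      using UV by auto
    have V: "open V" "V \<subseteq> manifold_carrier A" and C1: "\<And>k. C1_vector_field_on A V (E k)"
      using E by (auto simp: local_basis_def)
    obtain X where X: "C1_vector_field A X" "X c p = E i c p"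
      using C1_vector_field_with_value[OF assms(1) V C1 c pV] .
    obtain Y where Y: "C1_vector_field A Y" "Y c p = E j c p"
      using C1_vector_field_with_value[OF assms(1) V C1 c pV] .
    let ?\<delta> = "\<lambda>i k. if k = i then 1 else (0::real)"
    have x: "X c p = (\<Sum>k\<in>UNIV. ?\<delta> i k *\<^sub>R E k c p)"
      by (simp add: X if_distrib[of "\<lambda>t. t *\<^sub>R _"] cong: if_cong)
    have y: "Y c p = (\<Sum>k\<in>UNIV. ?\<delta> j k *\<^sub>R E k c p)"
      by (simp add: Y if_distrib[of "\<lambda>t. t *\<^sub>R _"] cong: if_cong)
    have "(\<Sum>k\<in>UNIV. \<Sum>l\<in>UNIV. (?\<delta> i k * ?\<delta> j l) *\<^sub>R lie_bracket (E k) (E l) c p)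
        = (\<Sum>k\<in>UNIV. if k = i then lie_bracket (E k) (E j) c p else 0)"
      by (intro sum.cong refl) (simp add: if_distrib[of "\<lambda>t. t *\<^sub>R _"] cong: if_cong)
    then have "torsion S X Y c p = - lie_bracket (E i) (E j) c p"
      by (simp add: torsion_vanishing_components[OF E W X(1) Y(1) c p x y])
    moreover have "torsion S X Y c p = 0"
      using tf X(1) Y(1) c pU by (simp add: torsion_free_on_def vanishes_on_def)
    ultimately show "lie_bracket (E i) (E j) c p = 0"
      by simp
  qed
qed

end
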